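(* $[\mathbf{Txt}\mathbf{Psd}\mathbf{Bc}_C]_{\mathbf{REC}} = [\mathbf{Txt}\mathbf{G}\mathbf{Bc}_C]_{\mathbf{REC}}$.
   Context: Fix an acceptable numbering $(\varphi_e)_{e\in\mathbb{N}}$ of all partial computable functions. A number $e$ is a $C$-index if $\varphi_e$ is total with values in $\{0,1\}$; then $C_e=\{x:\varphi_e(x)=1\}$. $\mathbf{REC}$ is the collection of recursive subsets of $\mathbb{N}$; $\mathcal{P}$ denotes the partial computable functions. Fix a pause symbol $\#$. A text is a total function $T:\mathbb{N}\to\mathbb{N}\cup\{\#\}$, $\mathrm{content}(T)=\mathrm{range}(T)\setminus\{\#\}$, $T$ is a text for $L$ if $\mathrm{content}(T)=L$, $T[n]=(T(0),\dots,T(n-1))$. A learner is some $h\in\mathcal{P}$ (finite sequences/sets coded as numbers). Hypothesis sequences: $\mathbf{G}(h,T)(i)=h(T[i])$; partially set-driven $\mathbf{Psd}(h,T)(i)=h(\mathrm{content}(T[i]),i)$. Restriction $\mathbf{Bc}_C$ on hypothesis sequence $p$ and text $T$: there is $n_0$ such that for all $n\ge n_0$, $p(n)$ is a $C$-index with $C_{p(n)}=\mathrm{content}(T)$. A learner $h$ $\mathbf{Txt}\beta\mathbf{Bc}_C$-learns $L$ iff $\mathbf{Bc}_C(\beta(h,T),T)$ holds for every text $T$ for $L$; $[\mathbf{Txt}\beta\mathbf{Bc}_C]_{\mathbf{REC}}$ is the set of all classes $\mathcal{L}\subseteq\mathbf{REC}$ for which some $h\in\mathcal{P}$ learns every $L\in\mathcal{L}$.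 *)

theory Defs
  imports Main "HOL-Library.Nat_Bijection"
begin

text \<open>
  Kleene's schemata for partial functions on the natural numbers, in unary form: a function of
  several arguments takes them packed by the Cantor pairing \<^const>\<open>prod_encode\<close>.
  Minimisation is strict: the search diverges as soon as it meets an undefined value.
\<close>

inductive partial_computable :: "(nat \<Rightarrow> nat option) \<Rightarrow> bool" where
  zero: "partial_computable (\<lambda>_. Some 0)"
| succ: "partial_computable (\<lambda>n. Some (Suc n))"
| left: "partial_computable (\<lambda>n. Some (fst (prod_decode n)))"
| right: "partial_computable (\<lambda>n. Some (snd (prod_decode n)))"
| pair: "partial_computable f \<Longrightarrow> partial_computable g \<Longrightarrow>
    partial_computable (\<lambda>n. Option.bind (f n) (\<lambda>x. Option.bind (g n) (\<lambda>y. Some (prod_encode (x, y)))))"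
| comp: "partial_computable f \<Longrightarrow> partial_computable g \<Longrightarrow>
    partial_computable (\<lambda>n. Option.bind (g n) f)"
| prim_rec: "partial_computable f \<Longrightarrow> partial_computable g \<Longrightarrow>
    partial_computable (\<lambda>n. case prod_decode n of (a, m) \<Rightarrow>
      rec_nat (f a) (\<lambda>k r. Option.bind r (\<lambda>y. g (prod_encode (a, prod_encode (k, y))))) m)"
| minimise: "partial_computable f \<Longrightarrow>
    partial_computable (\<lambda>a.
      if \<exists>n. f (prod_encode (a, n)) = Some 0 \<and> (\<forall>m<n. f (prod_encode (a, m)) \<noteq> None)
      then Some (LEAST n. f (prod_encode (a, n)) = Some 0) else None)"

definition computable :: "(nat \<Rightarrow> nat) \<Rightarrow> bool" where
  "computable f \<longleftrightarrow> partial_computable (\<lambda>n. Some (f n))"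

definition REC :: "nat set set" where
  "REC = {L. computable (\<lambda>x. if x \<in> L then 1 else 0)}"

text \<open>
  Acceptable in the sense of Rogers: the numbering is itself computable, and every computable
  sequence of partial functions can be compiled into it.
\<close>

definition acceptable_numbering :: "(nat \<Rightarrow> nat \<Rightarrow> nat option) \<Rightarrow> bool" where
  "acceptable_numbering \<phi> \<longleftrightarrow>
     range \<phi> = Collect partial_computable \<and>
     partial_computable (\<lambda>n. case prod_decode n of (e, x) \<Rightarrow> \<phi> e x) \<and>
     (\<forall>\<psi>. partial_computable (\<lambda>n. case prod_decode n of (e, x) \<Rightarrow> \<psi> e x) \<longrightarrow>
        (\<exists>c. computable c \<and> (\<forall>e. \<phi> (c e) = \<psi> e)))"

definition C_index :: "(nat \<Rightarrow> nat \<Rightarrow> nat option) \<Rightarrow> nat \<Rightarrow> bool" where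
  "C_index \<phi> e \<longleftrightarrow> (\<forall>x. \<phi> e x = Some 0 \<or> \<phi> e x = Some 1)"

definition C_set :: "(nat \<Rightarrow> nat \<Rightarrow> nat option) \<Rightarrow> nat \<Rightarrow> nat set" where
  "C_set \<phi> e = {x. \<phi> e x = Some 1}"

text \<open>In texts and their initial segments, \<^const>\<open>None\<close> is the pause symbol.\<close>

type_synonym text_seq = "nat \<Rightarrow> nat option"

definition content :: "text_seq \<Rightarrow> nat set" where
  "content T = {x. Some x \<in> range T}"

definition initial_segment :: "text_seq \<Rightarrow> nat \<Rightarrow> nat option list" where
  "initial_segment T n = map T [0..<n]"

definition content_list :: "nat option list \<Rightarrow> nat set" where
  "content_list \<sigma> = {x. Some x \<in> set \<sigma>}"

definition seq_encode :: "nat option list \<Rightarrow> nat" where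
  "seq_encode \<sigma> = list_encode (map (\<lambda>s. case s of None \<Rightarrow> 0 | Some x \<Rightarrow> Suc x) \<sigma>)"

type_synonym learner = "nat \<Rightarrow> nat option"

text \<open>
  Learners may be partial, so hypothesis sequences are partial too: \<^const>\<open>None\<close> means that
  the learner diverges at that stage.
\<close>

type_synonym hyp_seq = "nat \<Rightarrow> nat option"

type_synonym interaction_operator = "learner \<Rightarrow> text_seq \<Rightarrow> hyp_seq"

definition G :: interaction_operator where
  "G h T i = h (seq_encode (initial_segment T i))"

definition Psd :: interaction_operator where
  "Psd h T i = h (prod_encode (set_encode (content_list (initial_segment T i)), i))"

definition Bc_C :: "(nat \<Rightarrow> nat \<Rightarrow> nat option) \<Rightarrow> hyp_seq \<Rightarrow> text_seq \<Rightarrow> bool" where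
  "Bc_C \<phi> p T \<longleftrightarrow>
     (\<exists>n0. \<forall>n\<ge>n0. \<exists>e. p n = Some e \<and> C_index \<phi> e \<and> C_set \<phi> e = content T)"

definition Txt_Bc_C_learns ::
  "(nat \<Rightarrow> nat \<Rightarrow> nat option) \<Rightarrow> interaction_operator \<Rightarrow> learner \<Rightarrow> nat set \<Rightarrow> bool" where
  "Txt_Bc_C_learns \<phi> \<beta> h L \<longleftrightarrow> (\<forall>T. content T = L \<longrightarrow> Bc_C \<phi> (\<beta> h T) T)"

definition Txt_Bc_C_REC ::
  "(nat \<Rightarrow> nat \<Rightarrow> nat option) \<Rightarrow> interaction_operator \<Rightarrow> nat set set set" where
  "Txt_Bc_C_REC \<phi> \<beta> =
     {\<L>. \<L> \<subseteq> REC \<and> (\<exists>h. partial_computable h \<and> (\<forall>L\<in>\<L>. Txt_Bc_C_learns \<phi> \<beta> h L))}"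

end

theory Submission imports Defs begin

text \<open>
  A \<open>G\<close>-learner sees content and length of the initial segment, so it can simulate a
  \<open>Psd\<close>-learner. Conversely, let \<open>h\<close> be a \<open>G\<close>-learner and write \<open>D\<close> for the content and
  \<open>t\<close> for the length of the segment. Take the sequence \<open>\<sigma>\<close> of least code over \<open>D\<close> for which a search
  bounded by \<open>t\<close> finds no two extensions over \<open>D\<close> whose hypotheses disagree at some point, and
  conjecture the function that maps \<open>x\<close> to the first value found among
  \<open>\<phi>\<^bsub>h(\<sigma>\<tau>)\<^esub>(x)\<close> with \<open>\<tau>\<close> over \<open>D\<close>. On a text for a learned language \<open>L\<close>, a locking
  sequence is never discarded, so in the limit \<open>\<sigma>\<close> is at most the least locking sequence.
  Every sequence over \<open>L\<close> has an extension with a correct hypothesis. Hence a \<open>\<sigma>\<close> that is never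
  discarded has no extension that outputs a wrong value, even if some of its hypotheses are partial,
  and once \<open>D\<close> contains the content of a correct extension the conjectured function is total.
\<close>

section \<open>Computable functions and decidable predicates\<close>

abbreviation lft :: "nat \<Rightarrow> nat" where "lft n \<equiv> fst (prod_decode n)"
abbreviation rgt :: "nat \<Rightarrow> nat" where "rgt n \<equiv> snd (prod_decode n)"

definition decidable :: "(nat \<Rightarrow> bool) \<Rightarrow> bool" where
  "decidable P \<longleftrightarrow> computable (\<lambda>n. if P n then 1 else 0)"

text \<open>Closure rules for expressions in one input variable, so that
  \<open>intro comp_intro\<close> follows the syntax of a term. Functions of several variables take
  the form \<open>g (lft p) (rgt p)\<close>.\<close>

named_theorems comp_intro

lemma partial_computable_cong:
  "partial_computable f \<Longrightarrow> (\<And>n. f n = g n) \<Longrightarrow> partial_computable g"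
  by (metis ext)

lemma computable_cong: "computable f \<Longrightarrow> (\<And>n. f n = g n) \<Longrightarrow> computable g"
  by (metis ext)

lemma partial_computable_Some: "computable f \<Longrightarrow> partial_computable (\<lambda>n. Some (f n))"
  by (simp add: computable_def)

text \<open>The schema \<open>comp\<close> forgets the input of the inner function; pairing
  \<open>n\<close> with the value of \<open>f\<close> first lets the continuation \<open>g n\<close>
  depend on \<open>n\<close> too.\<close>

lemma partial_computable_bind:
  assumes "partial_computable f" "partial_computable (\<lambda>p. g (lft p) (rgt p))"
  shows "partial_computable (\<lambda>n. Option.bind (f n) (g n))"
proof -
  have "partial_computable (\<lambda>n. Some n)"
    by (rule partial_computable_cong[OF partial_computable.pair[OF partial_computable.left partial_computable.right]])
      simp
  from partial_computable.comp[OF assms(2) partial_computable.pair[OF this assms(1)]]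
  show ?thesis
    by (rule partial_computable_cong) (simp split: Option.bind_split)
qed

lemma computable_id [comp_intro]: "computable (\<lambda>n. n)"
  unfolding computable_def
  by (rule partial_computable_cong[OF partial_computable.pair[OF partial_computable.left partial_computable.right]])
    simp

lemma computable_compose: "computable f \<Longrightarrow> computable g \<Longrightarrow> computable (\<lambda>n. f (g n))"
  unfolding computable_def by (drule (1) partial_computable.comp) simp

lemma partial_computable_compose:
  "partial_computable f \<Longrightarrow> computable g \<Longrightarrow> partial_computable (\<lambda>n. f (g n))"
  unfolding computable_def by (drule (1) partial_computable.comp) simp

lemma computable_Suc [comp_intro]: "computable f \<Longrightarrow> computable (\<lambda>n. Suc (f n))"
  by (rule computable_compose[of Suc]) (simp_all add: computable_def partial_computable.succ)

lemma computable_lft [comp_intro]: "computable f \<Longrightarrow> computable (\<lambda>n. lft (f n))"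
  by (rule computable_compose[of lft]) (simp_all add: computable_def partial_computable.left)

lemma computable_rgt [comp_intro]: "computable f \<Longrightarrow> computable (\<lambda>n. rgt (f n))"
  by (rule computable_compose[of rgt]) (simp_all add: computable_def partial_computable.right)

lemma computable_prod_encode [comp_intro]:
  "computable f \<Longrightarrow> computable g \<Longrightarrow> computable (\<lambda>n. prod_encode (f n, g n))"
  unfolding computable_def by (drule (1) partial_computable.pair) simp

lemma computable_zero [comp_intro]: "computable (\<lambda>_. 0)"
  by (simp add: computable_def partial_computable.zero)

lemma computable_const: "computable (\<lambda>_. c)"
  by (induction c) (auto intro: comp_intro)

lemma computable_one [comp_intro]: "computable (\<lambda>_. 1)"
  and computable_numeral [comp_intro]: "computable (\<lambda>_. numeral k)"
  by (rule computable_const)+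

text \<open>The parameter of \<open>prim_rec\<close> is taken to be the whole input
  \<open>n\<close>, so base and step may depend on everything in scope.\<close>

lemma computable_rec_nat [comp_intro]:
  assumes "computable f" "computable m"
    and "computable (\<lambda>p. g (lft p) (lft (rgt p)) (rgt (rgt p)))"
  shows "computable (\<lambda>n. rec_nat (f n) (g n) (m n))"
proof -
  have "(rec_nat (Some (f a)) (\<lambda>k r. Option.bind r (\<lambda>y. Some (g a k y))) m) = Some (rec_nat (f a) (g a) m)"
    for a m by (induction m) simp_all
  then have "computable (\<lambda>p. rec_nat (f (lft p)) (g (lft p)) (rgt p))"
    using partial_computable.prim_rec[OF assms(1,3)[unfolded computable_def]]
    unfolding computable_def by (simp add: case_prod_beta)
  from computable_compose[OF this computable_prod_encode[OF computable_id assms(2)]]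
  show ?thesis by simp
qed

section \<open>Arithmetic\<close>

lemma computable_pred [comp_intro]:
  assumes "computable f"
  shows "computable (\<lambda>n. f n - 1)"
proof -
  have "rec_nat 0 (\<lambda>k _. k) m = m - 1" for m by (cases m) simp_all
  then show ?thesis
    using computable_rec_nat[of "\<lambda>_. 0" f "\<lambda>_ k _. k"] assms
    by (simp add: comp_intro)
qed

lemma computable_diff [comp_intro]:
  assumes "computable f" "computable g"
  shows "computable (\<lambda>n. f n - g n)"
proof -
  have "rec_nat a (\<lambda>_ r. r - 1) m = a - m" for a m :: nat by (induction m) simp_all
  then show ?thesis
    using computable_rec_nat[of f g "\<lambda>_ _ r. r - 1"] assms
    by (simp add: comp_intro del: One_nat_def)
qed

lemma computable_add [comp_intro]:
  assumes "computable f" "computable g"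
  shows "computable (\<lambda>n. f n + g n)"
proof -
  have "rec_nat a (\<lambda>_ r. Suc r) m = a + m" for a m :: nat by (induction m) simp_all
  then show ?thesis
    using computable_rec_nat[of f g "\<lambda>_ _ r. Suc r"] assms by (simp add: comp_intro)
qed

lemma computable_mult [comp_intro]:
  assumes "computable f" "computable g"
  shows "computable (\<lambda>n. f n * g n)"
proof -
  have "rec_nat 0 (\<lambda>_ r. r + a) m = a * m" for a m :: nat by (induction m) simp_all
  then show ?thesis
    using computable_rec_nat[of "\<lambda>_. 0" g "\<lambda>n _ r. r + f n"]
      computable_compose[OF assms(1)] assms(2) by (simp add: comp_intro)
qed

lemma computable_power [comp_intro]:
  assumes "computable f" "computable g"
  shows "computable (\<lambda>n. f n ^ g n)"
proof -
  have "rec_nat 1 (\<lambda>_ r. r * a) m = a ^ m" for a m :: nat by (induction m) simp_all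
  then show ?thesis
    using computable_rec_nat[of "\<lambda>_. 1" g "\<lambda>n _ r. r * f n"]
      computable_compose[OF assms(1)] assms(2) by (simp add: comp_intro del: One_nat_def)
qed

section \<open>Decidable predicates\<close>

lemma decidable_compose: "decidable P \<Longrightarrow> computable f \<Longrightarrow> decidable (\<lambda>n. P (f n))"
  unfolding decidable_def by (rule computable_compose)

lemma computable_if [comp_intro]:
  assumes "decidable P" "computable f" "computable g"
  shows "computable (\<lambda>n. if P n then f n else g n)"
proof -
  \<comment> \<open>A recursion of length 1 or 0: a single step overwrites the base
    \<open>g n\<close> by \<open>f n\<close>.\<close>
  have "computable (\<lambda>n. rec_nat (g n) (\<lambda>_ _. f n) (if P n then 1 else 0))"
    using assms computable_compose[OF assms(2)] unfolding decidable_def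
    by (intro comp_intro) (auto intro: comp_intro)
  then show ?thesis by (rule computable_cong) simp
qed

lemma decidable_eq_zero:
  assumes "computable f"
  shows "decidable (\<lambda>n. f n = 0)"
proof -
  have "computable (\<lambda>n. rec_nat 1 (\<lambda>_ _. 0) (f n))"
    using assms by (intro comp_intro)
  then show ?thesis unfolding decidable_def
    by (rule computable_cong) (metis nat.exhaust old.nat.simps(6,7))
qed

lemma decidable_eq [comp_intro]:
  assumes "computable f" "computable g"
  shows "decidable (\<lambda>n. f n = g n)"
proof -
  have "decidable (\<lambda>n. (f n - g n) + (g n - f n) = 0)"
    using assms by (intro decidable_eq_zero comp_intro)
  moreover have "(a - b) + (b - a) = 0 \<longleftrightarrow> a = b" for a b :: nat by auto
  ultimately show ?thesis by simp
qed

lemma decidable_le [comp_intro]: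
  assumes "computable f" "computable g"
  shows "decidable (\<lambda>n. f n \<le> g n)"
  using decidable_eq_zero[OF computable_diff[OF assms]] by simp

lemma decidable_not [comp_intro]:
  assumes "decidable P"
  shows "decidable (\<lambda>n. \<not> P n)"
  using computable_if[OF assms computable_zero computable_one]
  unfolding decidable_def by (rule computable_cong) simp

lemma decidable_less [comp_intro]:
  assumes "computable f" "computable g"
  shows "decidable (\<lambda>n. f n < g n)"
  using decidable_not[OF decidable_le[OF assms(2,1)]] by (simp add: not_le)

lemma decidable_conj [comp_intro]:
  assumes "decidable P" "decidable Q"
  shows "decidable (\<lambda>n. P n \<and> Q n)"
  using computable_if[OF assms(1) assms(2)[unfolded decidable_def] computable_zero]
  unfolding decidable_def by (rule computable_cong) simp

lemma decidable_disj [comp_intro]: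
  assumes "decidable P" "decidable Q"
  shows "decidable (\<lambda>n. P n \<or> Q n)"
  using computable_if[OF assms(1) computable_one assms(2)[unfolded decidable_def]]
  unfolding decidable_def by (rule computable_cong) simp

section \<open>Bounded and unbounded search\<close>

lemma decidable_bex_less [comp_intro]:
  assumes "computable m" "decidable (\<lambda>p. P (lft p) (rgt p))"
  shows "decidable (\<lambda>n. \<exists>k<m n. P n k)"
proof -
  have P: "decidable (\<lambda>p. P (lft p) (lft (rgt p)))"
    using decidable_compose[OF assms(2), of "\<lambda>p. prod_encode (lft p, lft (rgt p))"]
    by (simp add: comp_intro)
  have "rec_nat (0::nat) (\<lambda>k r. if P n k then 1 else r) m = (if \<exists>k<m. P n k then 1 else 0)" for n m
    by (induction m) (auto simp: less_Suc_eq)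
  moreover have "computable (\<lambda>n. rec_nat 0 (\<lambda>k r. if P n k then 1 else r) (m n))"
    using assms(1) P by (intro comp_intro)
  ultimately show ?thesis unfolding decidable_def by simp
qed

text \<open>\<open>minimise\<close> looks for a zero, hence the inverted truth values; the test is
  total, so the strictness of the search cannot block it.\<close>

lemma partial_computable_Least:
  assumes "decidable (\<lambda>p. P (lft p) (rgt p))"
  shows "partial_computable (\<lambda>n. if \<exists>k. P n k then Some (LEAST k. P n k) else None)"
proof -
  have "computable (\<lambda>p. if P (lft p) (rgt p) then 0 else 1)"
    using assms by (intro comp_intro)
  from partial_computable.minimise[OF this[unfolded computable_def]]
  show ?thesis
    by (rule partial_computable_cong) (simp cong: conj_cong)
qed

lemma computable_Least [comp_intro]:
  assumes "decidable (\<lambda>p. P (lft p) (rgt p))" "\<And>n. \<exists>k. P n k"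
  shows "computable (\<lambda>n. LEAST k. P n k)"
  using partial_computable_Least[OF assms(1)] unfolding computable_def by (simp add: assms(2))

text \<open>The quotient is the first \<open>q\<close> with \<open>f n < Suc q * g n\<close>; a
  positive divisor makes this search terminate.\<close>

lemma computable_div [comp_intro]:
  assumes "computable f" "computable g" "\<And>n. 0 < g n"
  shows "computable (\<lambda>n. f n div g n)"
proof -
  have lt: "a < Suc (a div b) * b" if "0 < b" for a b :: nat
    using dividend_less_div_times[OF that, of a] by (simp add: mult.commute)
  have L: "(LEAST q. a < Suc q * b) = a div b" if "0 < b" for a b :: nat
    using lt[OF that] by (intro Least_equality) (auto dest: less_mult_imp_div_less simp del: mult_Suc)
  have "\<exists>q. f n < Suc q * g n" for n
    using lt[OF assms(3)] by blast
  then have "computable (\<lambda>n. LEAST q. f n < Suc q * g n)"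
    by (intro comp_intro computable_compose[OF assms(1)] computable_compose[OF assms(2)]) auto
  then show ?thesis by (simp only: L assms(3))
qed

lemma decidable_even [comp_intro]:
  assumes "computable f"
  shows "decidable (\<lambda>n. even (f n))"
proof -
  have "decidable (\<lambda>n. f n - 2 * (f n div 2) = 0)"
    using assms by (intro comp_intro) auto
  moreover have "a - 2 * (a div 2) = 0 \<longleftrightarrow> even a" for a :: nat
    by (metis even_iff_mod_2_eq_zero minus_mult_div_eq_mod)
  ultimately show ?thesis by simp
qed

section \<open>Step-bounded evaluation\<close>

text \<open>
  Stage-wise approximation from below: the values are \<open>0\<close> (no output yet) or
  \<open>Suc v\<close> (output \<open>v\<close>).
\<close>

definition approximates :: "(nat \<Rightarrow> nat \<Rightarrow> nat) \<Rightarrow> (nat \<Rightarrow> nat option) \<Rightarrow> bool" where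
  "approximates F f \<longleftrightarrow>
     computable (\<lambda>p. F (lft p) (rgt p)) \<and>
     (\<forall>n v. f n = Some v \<longrightarrow> (\<exists>s. \<forall>t\<ge>s. F n t = Suc v)) \<and>
     (\<forall>n s v. F n s = Suc v \<longrightarrow> f n = Some v)"

lemma approximatesI:
  assumes "computable (\<lambda>p. F (lft p) (rgt p))"
    and "\<And>n v. f n = Some v \<Longrightarrow> \<exists>s. \<forall>t\<ge>s. F n t = Suc v"
    and "\<And>n s v. F n s = Suc v \<Longrightarrow> f n = Some v"
  shows "approximates F f"
  using assms by (simp add: approximates_def)

lemma approximates_total: "computable f \<Longrightarrow> approximates (\<lambda>n s. Suc (f n)) (\<lambda>n. Some (f n))"
  by (rule approximatesI) (auto intro!: comp_intro intro: computable_compose[of f])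

lemma approximatesD:
  assumes "approximates F f"
  shows "computable a \<Longrightarrow> computable b \<Longrightarrow> computable (\<lambda>n. F (a n) (b n))"
    and "f n = Some v \<Longrightarrow> \<exists>s. \<forall>t\<ge>s. F n t = Suc v"
    and "F n s = Suc v \<Longrightarrow> f n = Some v"
proof -
  assume "computable a" "computable b"
  then show "computable (\<lambda>n. F (a n) (b n))"
    using computable_compose[of "\<lambda>p. F (lft p) (rgt p)" "\<lambda>n. prod_encode (a n, b n)"] assms
    by (simp add: approximates_def comp_intro)
qed (use assms in \<open>auto simp: approximates_def\<close>)

section \<open>Closure of approximations under the schemata\<close>

lemma approximates_pair:
  assumes F: "approximates F f" and H: "approximates H g"
  shows "approximates (\<lambda>n s. if F n s = 0 \<or> H n s = 0 then 0 else Suc (prod_encode (F n s - 1, H n s - 1)))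
    (\<lambda>n. Option.bind (f n) (\<lambda>x. Option.bind (g n) (\<lambda>y. Some (prod_encode (x, y)))))"
proof (rule approximatesI)
  show "computable (\<lambda>p. if F (lft p) (rgt p) = 0 \<or> H (lft p) (rgt p) = 0 then 0
    else Suc (prod_encode (F (lft p) (rgt p) - 1, H (lft p) (rgt p) - 1)))"
    by (intro comp_intro approximatesD(1)[OF F] approximatesD(1)[OF H])
next
  fix n v
  assume "Option.bind (f n) (\<lambda>x. Option.bind (g n) (\<lambda>y. Some (prod_encode (x, y)))) = Some v"
  then obtain x y where "f n = Some x" "g n = Some y" "v = prod_encode (x, y)"
    by (auto simp: bind_eq_Some_conv)
  moreover from this obtain s s' where "\<forall>t\<ge>s. F n t = Suc x" "\<forall>t\<ge>s'. H n t = Suc y"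
    using approximatesD(2)[OF F] approximatesD(2)[OF H] by blast
  ultimately show "\<exists>s. \<forall>t\<ge>s. (if F n t = 0 \<or> H n t = 0 then 0 else Suc (prod_encode (F n t - 1, H n t - 1))) = Suc v"
    by (intro exI[of _ "max s s'"]) simp
next
  fix n s v
  assume *: "(if F n s = 0 \<or> H n s = 0 then 0 else Suc (prod_encode (F n s - 1, H n s - 1))) = Suc v"
  then obtain x y where "F n s = Suc x" "H n s = Suc y"
    by (cases "F n s"; cases "H n s") auto
  with * approximatesD(3)[OF F, of n s x] approximatesD(3)[OF H, of n s y]
  show "Option.bind (f n) (\<lambda>x. Option.bind (g n) (\<lambda>y. Some (prod_encode (x, y)))) = Some v"
    by simp
qed

lemma approximates_comp:
  assumes F: "approximates F f" and H: "approximates H g"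
  shows "approximates (\<lambda>n s. if H n s = 0 then 0 else F (H n s - 1) s) (\<lambda>n. Option.bind (g n) f)"
proof (rule approximatesI)
  show "computable (\<lambda>p. if H (lft p) (rgt p) = 0 then 0 else F (H (lft p) (rgt p) - 1) (rgt p))"
    by (intro comp_intro approximatesD(1)[OF F] approximatesD(1)[OF H])
next
  fix n v
  assume "Option.bind (g n) f = Some v"
  then obtain y where "g n = Some y" "f y = Some v"
    by (auto simp: bind_eq_Some_conv)
  moreover from this obtain s s' where "\<forall>t\<ge>s. F y t = Suc v" "\<forall>t\<ge>s'. H n t = Suc y"
    using approximatesD(2)[OF F] approximatesD(2)[OF H] by blast
  ultimately show "\<exists>s. \<forall>t\<ge>s. (if H n t = 0 then 0 else F (H n t - 1) t) = Suc v"
    by (intro exI[of _ "max s s'"]) simp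
next
  fix n s v
  assume *: "(if H n s = 0 then 0 else F (H n s - 1) s) = Suc v"
  then obtain y where "H n s = Suc y"
    by (cases "H n s") auto
  with * approximatesD(3)[OF F, of y s v] approximatesD(3)[OF H, of n s y]
  show "Option.bind (g n) f = Some v"
    by simp
qed

text \<open>One stage \<open>s\<close> is used for all calls, and \<open>0\<close> is passed on once
  a call has no output. A defined recursion makes finitely many calls, each constant from some stage
  on, so a common threshold exists.\<close>

lemma approximates_prim_rec:
  fixes f g F H
  defines "R \<equiv> \<lambda>a m. rec_nat (f a) (\<lambda>k r. Option.bind r (\<lambda>y. g (prod_encode (a, prod_encode (k, y))))) m"
    and "S \<equiv> \<lambda>a m s. rec_nat (F a s) (\<lambda>k r. if r = 0 then 0 else H (prod_encode (a, prod_encode (k, r - 1))) s) m"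
  assumes F: "approximates F f" and H: "approximates H g"
  shows "approximates (\<lambda>n s. S (lft n) (rgt n) s) (\<lambda>n. R (lft n) (rgt n))"
proof (rule approximatesI)
  show "computable (\<lambda>p. S (lft (lft p)) (rgt (lft p)) (rgt p))"
    unfolding S_def by (intro comp_intro approximatesD(1)[OF F] approximatesD(1)[OF H])
next
  have "\<exists>s. \<forall>t\<ge>s. S a m t = Suc v" if "R a m = Some v" for a m v
    using that
  proof (induction m arbitrary: v)
    case 0
    then show ?case using approximatesD(2)[OF F] by (simp add: R_def S_def)
  next
    case (Suc m)
    then obtain y where "R a m = Some y" and y: "g (prod_encode (a, prod_encode (m, y))) = Some v"
      by (auto simp: bind_eq_Some_conv R_def)
    with Suc.IH obtain s where "\<forall>t\<ge>s. S a m t = Suc y" by blast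
    moreover obtain s' where "\<forall>t\<ge>s'. H (prod_encode (a, prod_encode (m, y))) t = Suc v"
      using approximatesD(2)[OF H y] by blast
    ultimately show ?case
      by (intro exI[of _ "max s s'"]) (simp add: S_def)
  qed
  then show "\<exists>s. \<forall>t\<ge>s. S (lft n) (rgt n) t = Suc v" if "R (lft n) (rgt n) = Some v" for n v
    using that .
next
  have "R a m = Some v" if "S a m s = Suc v" for a m s v
    using that
  proof (induction m arbitrary: v)
    case 0
    then show ?case using approximatesD(3)[OF F] by (simp add: R_def S_def)
  next
    case (Suc m)
    then obtain y where y: "S a m s = Suc y"
      by (cases "S a m s") (auto simp: S_def)
    with Suc.prems have "H (prod_encode (a, prod_encode (m, y))) s = Suc v"
      by (simp add: S_def)
    with Suc.IH[OF y] approximatesD(3)[OF H] show ?case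
      by (simp add: R_def)
  qed
  then show "R (lft n) (rgt n) = Some v" if "S (lft n) (rgt n) s = Suc v" for n s v
    using that .
qed

text \<open>
  In the state of the bounded search, \<open>0\<close> stands for ``still searching'', \<open>1\<close> for
  ``met an undefined value'' and \<open>Suc (Suc n)\<close> for ``found \<open>n\<close>''.
\<close>

lemma approximates_minimise:
  fixes f F
  defines "S \<equiv> \<lambda>a m s. rec_nat 0 (\<lambda>k r. if r \<noteq> 0 then r else if F (prod_encode (a, k)) s = 0 then 1
      else if F (prod_encode (a, k)) s = 1 then Suc (Suc k) else 0) m"
  assumes F: "approximates F f"
  shows "approximates (\<lambda>a s. S a s s - 1) (\<lambda>a.
    if \<exists>n. f (prod_encode (a, n)) = Some 0 \<and> (\<forall>m<n. f (prod_encode (a, m)) \<noteq> None)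
    then Some (LEAST n. f (prod_encode (a, n)) = Some 0) else None)"
    (is "approximates _ ?M")
proof (rule approximatesI)
  \<comment> \<open>The predecessor merges the states \<open>0\<close> and \<open>1\<close> into
    \<open>0\<close>, no output, and turns \<open>Suc (Suc n)\<close> into \<open>Suc n\<close>. The
    stage bounds both the evaluation and the search range.\<close>
  show "computable (\<lambda>p. S (lft p) (rgt p) (rgt p) - 1)"
    unfolding S_def by (intro comp_intro approximatesD(1)[OF F])
next
  have zero: "S a m s = 0" if "\<forall>k<m. 1 < F (prod_encode (a, k)) s" for a m s
    using that by (induction m) (auto simp: S_def)
  have found: "S a m s = Suc (Suc n)"
    if "\<forall>k<n. 1 < F (prod_encode (a, k)) s" "F (prod_encode (a, n)) s = 1" "n < m" for a m n s
    using that(3)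
  proof (induction m)
    case (Suc m)
    show ?case
    proof (cases "n = m")
      case True
      then show ?thesis using zero[OF that(1)] that(2) by (simp add: S_def)
    next
      case False
      with Suc show ?thesis by (simp add: S_def)
    qed
  qed simp
  fix a v
  assume "?M a = Some v"
  then obtain n where n: "f (prod_encode (a, n)) = Some 0" "\<forall>m<n. f (prod_encode (a, m)) \<noteq> None"
    and v: "v = (LEAST n. f (prod_encode (a, n)) = Some 0)"
    by (auto split: if_splits)
  have v0: "f (prod_encode (a, v)) = Some 0" and vn: "v \<le> n"
    using n(1) unfolding v by (auto intro: LeastI Least_le)
  \<comment> \<open>Minimality excludes zeros below \<open>v\<close>, and \<open>v \<le> n\<close>
    excludes undefined values. A positive value is approximated by a number above 1, since
    \<open>Suc 0\<close> stands for the output 0.\<close>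
  have lt: "\<exists>y. f (prod_encode (a, k)) = Some (Suc y)" if "k < v" for k
  proof -
    have "f (prod_encode (a, k)) \<noteq> None" using that vn n(2) by simp
    moreover have "f (prod_encode (a, k)) \<noteq> Some 0" using that not_less_Least unfolding v by blast
    ultimately show ?thesis by (metis not_None_eq not0_implies_Suc)
  qed
  have "\<exists>s. \<forall>t\<ge>s. \<forall>k<v. 1 < F (prod_encode (a, k)) t"
    using lt
  proof (induction v)
    case (Suc v)
    then obtain s where "\<forall>t\<ge>s. \<forall>k<v. 1 < F (prod_encode (a, k)) t" by auto
    moreover obtain y where "f (prod_encode (a, v)) = Some (Suc y)" using Suc.prems by blast
    from approximatesD(2)[OF F this] obtain s' where "\<forall>t\<ge>s'. F (prod_encode (a, v)) t = Suc (Suc y)" by blast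
    ultimately show ?case by (intro exI[of _ "max s s'"]) (auto simp: less_Suc_eq)
  qed simp
  then obtain s where "\<forall>t\<ge>s. \<forall>k<v. 1 < F (prod_encode (a, k)) t" by blast
  moreover obtain s' where "\<forall>t\<ge>s'. F (prod_encode (a, v)) t = 1"
    using approximatesD(2)[OF F v0] by auto
  \<comment> \<open>\<open>Suc v\<close> enters the maximum because \<open>S a t t\<close> inspects
    only positions below \<open>t\<close>.\<close>
  ultimately show "\<exists>s. \<forall>t\<ge>s. S a t t - 1 = Suc v"
    using found[of v a] by (intro exI[of _ "max (Suc v) (max s s')"]) (simp del: One_nat_def)
next
  \<comment> \<open>The state certifies the past of the search: \<open>Suc (Suc n)\<close> means a
    zero at \<open>n\<close> and positive values before it, which makes \<open>n\<close> the least
    zero of \<open>f\<close>.\<close>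
  have inv: "(S a m s = 0 \<longrightarrow> (\<forall>k<m. 1 < F (prod_encode (a, k)) s)) \<and>
    (\<forall>n. S a m s = Suc (Suc n) \<longrightarrow> (\<forall>k<n. 1 < F (prod_encode (a, k)) s) \<and> F (prod_encode (a, n)) s = 1)" for a m s
  proof (induction m)
    case (Suc m)
    then show ?case by (cases "S a m s") (auto simp: S_def less_Suc_eq)
  qed (simp add: S_def)
  fix a s v
  assume "S a s s - 1 = Suc v"
  then have "S a s s = Suc (Suc v)" by simp
  with inv have v: "F (prod_encode (a, v)) s = Suc 0" and lt: "\<forall>k<v. 1 < F (prod_encode (a, k)) s"
    by simp_all
  have v0: "f (prod_encode (a, v)) = Some 0" using approximatesD(3)[OF F v] .
  have lt': "\<exists>y. f (prod_encode (a, k)) = Some (Suc y)" if "k < v" for k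
  proof -
    have "1 < F (prod_encode (a, k)) s"
      using lt that by blast
    then have "F (prod_encode (a, k)) s = Suc (Suc (F (prod_encode (a, k)) s - 2))"
      by simp
    then show ?thesis using approximatesD(3)[OF F] by blast
  qed
  then have "\<forall>k<v. f (prod_encode (a, k)) \<noteq> None" by force
  moreover have "(LEAST n. f (prod_encode (a, n)) = Some 0) = v"
    using v0
  proof (rule Least_equality)
    show "v \<le> n" if "f (prod_encode (a, n)) = Some 0" for n
      using that lt'[of n] by (cases "n < v") auto
  qed
  ultimately show "?M a = Some v" using v0 by auto
qed

text \<open>Induction over the schemata takes the place of a machine model with step counting. It
  makes bounded simulation of a learner and its hypotheses available.\<close>

lemma partial_computable_approximates:
  "partial_computable f \<Longrightarrow> \<exists>F. approximates F f"
proof (induction rule: partial_computable.induct)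
  case zero
  show ?case using approximates_total[OF computable_zero] by blast
next
  case succ
  show ?case using approximates_total[OF computable_Suc[OF computable_id]] by blast
next
  case left
  show ?case using approximates_total[OF computable_lft[OF computable_id]] by blast
next
  case right
  show ?case using approximates_total[OF computable_rgt[OF computable_id]] by blast
next
  case (pair f g)
  then show ?case using approximates_pair by blast
next
  case (comp f g)
  then show ?case using approximates_comp by blast
next
  case (prim_rec f g)
  then show ?case using approximates_prim_rec[of _ f _ g] by (force simp: case_prod_beta)
next
  case (minimise f)
  then show ?case using approximates_minimise by blast
qed


section \<open>Coded sequences and finite sets\<close>

definition seq_decode :: "nat \<Rightarrow> nat option list" where
  "seq_decode n = map (\<lambda>s. if s = 0 then None else Some (s - 1)) (list_decode n)"

lemma seq_encode_inverse [simp]: "seq_decode (seq_encode \<sigma>) = \<sigma>"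
  by (simp add: seq_decode_def seq_encode_def o_def map_idI split: option.split)

lemma seq_decode_inverse [simp]: "seq_encode (seq_decode n) = n"
proof -
  have "map (case_option 0 Suc \<circ> (\<lambda>s. if s = 0 then None else Some (s - 1))) xs = xs" for xs
    by (rule map_idI) simp
  then show ?thesis by (simp add: seq_decode_def seq_encode_def)
qed

lemma seq_encode_append:
  "seq_encode (seq_decode a @ seq_decode b) = list_encode (list_decode a @ list_decode b)"
  by (metis list_encode_inverse map_append seq_decode_inverse seq_encode_def)

lemma finite_content_list [simp]: "finite (content_list \<sigma>)"
proof -
  have "content_list \<sigma> = Some -` set \<sigma>" by (auto simp: content_list_def)
  then show ?thesis by (simp add: finite_vimageI)
qed

lemma content_list_append [simp]: "content_list (\<sigma> @ \<tau>) = content_list \<sigma> \<union> content_list \<tau>"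
  by (auto simp: content_list_def)

text \<open>Allows a code to serve as the number of iterations when its list is traversed.\<close>

lemma length_le_list_encode: "length xs \<le> list_encode xs"
proof (induction xs)
  case (Cons x xs)
  then show ?case using le_prod_encode_2[of "list_encode xs" x] by simp
qed simp

text \<open>The recursion state pairs the code of the unread rest of the list with the accumulator.
  A nonempty list has the code \<open>Suc (prod_encode (x, c))\<close> with head \<open>x\<close>
  and tail code \<open>c\<close>; steps beyond the end change nothing.\<close>

lemma computable_fold:
  assumes g: "computable (\<lambda>p. g (lft p) (rgt p))" and l: "computable l" and f: "computable f"
  shows "computable (\<lambda>n. fold g (list_decode (l n)) (f n))"
proof -
  define step where "step p = (if lft p = 0 then p else
    prod_encode (rgt (lft p - 1), g (lft (lft p - 1)) (rgt p)))" for p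
  have g': "computable a \<Longrightarrow> computable b \<Longrightarrow> computable (\<lambda>n. g (a n) (b n))" for a b
    using computable_compose[OF g, of "\<lambda>n. prod_encode (a n, b n)"] by (simp add: comp_intro)
  have step: "step (prod_encode (list_encode (drop k xs), fold g (take k xs) a)) =
    prod_encode (list_encode (drop (Suc k) xs), fold g (take (Suc k) xs) a)" for k xs a
  proof (cases "k < length xs")
    case True
    then show ?thesis
      by (simp add: step_def Cons_nth_drop_Suc[symmetric] take_Suc_conv_app_nth)
  qed (simp add: step_def)
  have "rec_nat (prod_encode (list_encode xs, a)) (\<lambda>_. step) k =
    prod_encode (list_encode (drop k xs), fold g (take k xs) a)" for k xs a
    using step by (induction k) simp_all
  then have "rgt (rec_nat (prod_encode (c, a)) (\<lambda>_. step) c) = fold g (list_decode c) a" for c a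
    using length_le_list_encode[of "list_decode c"]
    by (metis list_decode_inverse prod_encode_inverse snd_conv take_all)
  moreover have "computable (\<lambda>n. rgt (rec_nat (prod_encode (l n, f n)) (\<lambda>_. step) (l n)))"
    using l f unfolding step_def by (intro comp_intro g')
  ultimately show ?thesis by simp
qed

lemma computable_length_seq_decode [comp_intro]:
  assumes "computable f"
  shows "computable (\<lambda>n. length (seq_decode (f n)))"
proof -
  have "fold (\<lambda>_. Suc) xs k = length xs + k" for xs :: "nat list" and k
    by (induction xs arbitrary: k) simp_all
  moreover have "computable (\<lambda>n. fold (\<lambda>_. Suc) (list_decode (f n)) 0)"
    using assms by (intro computable_fold comp_intro)
  ultimately show ?thesis by (simp add: seq_decode_def)
qed

lemma computable_seq_append [comp_intro]:
  assumes "computable f" "computable g"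
  shows "computable (\<lambda>n. seq_encode (seq_decode (f n) @ seq_decode (g n)))"
proof -
  \<comment> \<open>Pushing one list onto another reverses it: a first fold reverses the left list,
    a second one pushes the result onto the right list.\<close>
  let ?cons = "\<lambda>x r. Suc (prod_encode (x, r))"
  have push: "fold ?cons xs (list_encode ys) = list_encode (rev xs @ ys)" for xs ys
  proof (induction xs arbitrary: ys)
    case (Cons x xs)
    from Cons[of "x # ys"] show ?case by simp
  qed simp
  have "fold ?cons (list_decode (fold ?cons (list_decode a) 0)) b =
    seq_encode (seq_decode a @ seq_decode b)" for a b
    using push[of "list_decode a" "[]"] push[of "rev (list_decode a)" "list_decode b"]
    by (simp add: seq_encode_append)
  moreover have "computable (\<lambda>n. fold ?cons (list_decode (fold ?cons (list_decode (f n)) 0)) (g n))"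
    using assms by (intro computable_fold comp_intro)
  ultimately show ?thesis by simp
qed

text \<open>Finite sets are coded by binary numerals, so insertion adds a power of 2 if the bit is
  not yet set. The entry \<open>0\<close> is the pause and changes nothing.\<close>

lemma computable_union_content:
  assumes "computable f" "computable g"
  shows "computable (\<lambda>n. set_encode (set_decode (f n) \<union> content_list (seq_decode (g n))))"
proof -
  define ins where "ins s D = (if s = 0 \<or> \<not> even (D div 2 ^ (s - 1)) then D else D + 2 ^ (s - 1))"
    for s D :: nat
  have ins: "set_decode (ins s D) = set_decode D \<union> content_list [if s = 0 then None else Some (s - 1)]"
    for s D
  proof (cases "s = 0 \<or> s - 1 \<in> set_decode D")
    case True
    then show ?thesis by (auto simp: ins_def set_decode_def content_list_def)
  next
    case False
    then have "set_encode (insert (s - 1) (set_decode D)) = 2 ^ (s - 1) + D"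
      using set_encode_insert[of "set_decode D" "s - 1"] by simp
    then have "set_decode (D + 2 ^ (s - 1)) = insert (s - 1) (set_decode D)"
      by (metis add.commute finite_insert finite_set_decode set_encode_inverse)
    with False show ?thesis by (auto simp: ins_def set_decode_def content_list_def)
  qed
  have "set_decode (fold ins xs D) =
    set_decode D \<union> content_list (map (\<lambda>s. if s = 0 then None else Some (s - 1)) xs)" for xs D
    by (induction xs arbitrary: D) (auto simp: ins content_list_def)
  then have "fold ins (list_decode c) D = set_encode (set_decode D \<union> content_list (seq_decode c))" for c D
    by (metis seq_decode_def set_decode_inverse)
  moreover have "computable (\<lambda>n. fold ins (list_decode (g n)) (f n))"
    using assms unfolding ins_def by (intro computable_fold comp_intro) simp_all
  ultimately show ?thesis by simp
qed

lemma computable_content [comp_intro]: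
  assumes "computable f"
  shows "computable (\<lambda>n. set_encode (content_list (seq_decode (f n))))"
  using computable_union_content[OF computable_zero assms] by simp

text \<open>Inclusion becomes equality of codes: joining the content must leave the code of the set
  unchanged.\<close>

lemma decidable_content_subset [comp_intro]:
  assumes "computable f" "computable g"
  shows "decidable (\<lambda>n. content_list (seq_decode (f n)) \<subseteq> set_decode (g n))"
proof -
  have "decidable (\<lambda>n. set_encode (set_decode (g n) \<union> content_list (seq_decode (f n))) = g n)"
    using assms by (intro comp_intro computable_union_content)
  moreover have "set_encode (set_decode D \<union> A) = D \<longleftrightarrow> A \<subseteq> set_decode D" if "finite A" for A D
    using that by (metis finite_UnI finite_set_decode set_decode_inverse set_encode_inverse sup.absorb_iff1)
  ultimately show ?thesis by simp
qed

section \<open>Locking sequences\<close>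

lemma length_initial_segment [simp]: "length (initial_segment T n) = n"
  by (simp add: initial_segment_def)

lemma content_initial_segment: "content_list (initial_segment T n) \<subseteq> content T"
  by (auto simp: content_list_def initial_segment_def content_def)

lemma eventually_subset_content_initial_segment:
  assumes "finite A" "A \<subseteq> content T"
  shows "\<forall>\<^sub>F n in sequentially. A \<subseteq> content_list (initial_segment T n)"
proof -
  have "\<forall>\<^sub>F n in sequentially. x \<in> content_list (initial_segment T n)" if "x \<in> A" for x
  proof -
    from that assms(2) obtain k where "T k = Some x" by (force simp: content_def)
    then show ?thesis
      by (intro eventually_mono[OF eventually_gt_at_top[of k]])
        (force simp: content_list_def initial_segment_def)
  qed
  with assms(1) show ?thesis by (simp add: subset_eq eventually_ball_finite_distrib)
qed

text \<open>
  Otherwise bad extensions, alternating with the elements of \<open>L\<close>, are concatenated to a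
  text for \<open>L\<close> with infinitely many bad initial segments.
\<close>

lemma exists_locking_extension:
  assumes good: "\<And>T. content T = L \<Longrightarrow> \<forall>\<^sub>F n in sequentially. good (initial_segment T n)"
    and \<sigma>: "content_list \<sigma> \<subseteq> L"
  shows "\<exists>\<tau>. content_list \<tau> \<subseteq> L \<and> (\<forall>\<rho>. content_list \<rho> \<subseteq> L \<longrightarrow> good (\<sigma> @ \<tau> @ \<rho>))"
proof (rule ccontr)
  assume "\<not> ?thesis"
  then obtain r where r: "content_list \<tau> \<subseteq> L \<Longrightarrow> content_list (r \<tau>) \<subseteq> L \<and> \<not> good (\<sigma> @ \<tau> @ r \<tau>)" for \<tau>
    by metis
  \<comment> \<open>\<open>b\<close> runs through all numbers and pauses outside \<open>L\<close>,
    which also covers an empty \<open>L\<close>.\<close>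
  define b where "b n = (if n \<in> L then Some n else None)" for n
  define E where "E = rec_nat [] (\<lambda>k \<tau>. (\<tau> @ [b k]) @ r (\<tau> @ [b k]))"
  define S where "S k = \<sigma> @ E k" for k
  \<comment> \<open>\<open>S k\<close> has length at least \<open>k\<close>, so entry
    \<open>n\<close> exists in \<open>S (Suc n)\<close>; as the \<open>S k\<close> extend one
    another, any long enough one gives the same entry.\<close>
  define T where "T n = S (Suc n) ! n" for n
  have E_Suc: "E (Suc k) = (E k @ [b k]) @ r (E k @ [b k])" for k
    by (simp add: E_def)
  have b: "content_list [b k] \<subseteq> L" for k
    by (auto simp: b_def content_list_def)
  have EL: "content_list (E k) \<subseteq> L" for k
  proof (induction k)
    case (Suc k)
    with b[of k] r[of "E k @ [b k]"] show ?case
      unfolding E_Suc content_list_append by blast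
  qed (simp add: E_def content_list_def)
  have bad: "\<not> good (S (Suc k))" for k
    using r[of "E k @ [b k]"] EL[of k] b[of k] by (simp add: E_Suc S_def)
  have len: "k \<le> length (S k)" for k
  proof (induction k)
    case (Suc k)
    then show ?case by (simp add: E_Suc S_def)
  qed simp
  have pre: "\<exists>\<rho>. S m = S k @ \<rho>" if "k \<le> m" for k m
    using that
  proof (induction m rule: dec_induct)
    case (step m)
    then show ?case by (auto simp: S_def E_Suc)
  qed simp
  have nth: "T n = S k ! n" if "n < length (S k)" for n k
  proof -
    obtain \<rho> \<rho>' where "S (max k (Suc n)) = S k @ \<rho>" "S (max k (Suc n)) = S (Suc n) @ \<rho>'"
      using pre[of k "max k (Suc n)"] pre[of "Suc n" "max k (Suc n)"] by auto
    then show ?thesis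
      using that len[of "Suc n"] unfolding T_def by (metis Suc_le_eq nth_append)
  qed
  have seg: "initial_segment T (length (S k)) = S k" for k
    by (rule nth_equalityI) (simp_all add: initial_segment_def nth)
  have "content T = L"
  proof
    show "content T \<subseteq> L"
    proof
      fix x
      assume "x \<in> content T"
      then obtain n where "Some x = S (Suc n) ! n" by (auto simp: content_def T_def)
      then have "x \<in> content_list (S (Suc n))"
        using len[of "Suc n"] by (simp add: content_list_def)
      then show "x \<in> L" using \<sigma> EL[of "Suc n"] by (auto simp: S_def)
    qed
    show "L \<subseteq> content T"
    proof
      fix x
      assume "x \<in> L"
      then have "x \<in> content_list (S (Suc x))" by (simp add: S_def E_Suc b_def content_list_def)
      then show "x \<in> content T"
        using content_initial_segment[of T "length (S (Suc x))"] by (auto simp: seg)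
    qed
  qed
  from good[OF this] obtain N where "\<forall>n\<ge>N. good (initial_segment T n)"
    by (auto simp: eventually_sequentially)
  \<comment> \<open>The bad segments \<open>S (Suc k)\<close> have unbounded length, so one of them
    lies beyond \<open>N\<close>.\<close>
  with len[of "Suc N"] have "good (S (Suc N))" by (metis Suc_leD seg)
  with bad show False by blast
qed

section \<open>Simulating full-information learners\<close>

definition hyp_value ::
  "(nat \<Rightarrow> nat \<Rightarrow> nat option) \<Rightarrow> learner \<Rightarrow> nat option list \<Rightarrow> nat \<Rightarrow> nat option" where
  "hyp_value \<phi> h \<sigma> y = Option.bind (h (seq_encode \<sigma>)) (\<lambda>e. \<phi> e y)"

lemma partial_computable_hyp_value:
  assumes "acceptable_numbering \<phi>" "partial_computable h"
  shows "partial_computable (\<lambda>p. hyp_value \<phi> h (seq_decode (lft p)) (rgt p))"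
proof -
  have "partial_computable (\<lambda>n. \<phi> (lft n) (rgt n))"
    using assms(1) by (simp add: acceptable_numbering_def case_prod_beta)
  from partial_computable_compose[OF this, of "\<lambda>q. prod_encode (rgt q, rgt (lft q))"]
  have "partial_computable (\<lambda>q. \<phi> (rgt q) (rgt (lft q)))"
    by (simp add: comp_intro)
  moreover have "partial_computable (\<lambda>p. h (lft p))"
    using assms(2) by (rule partial_computable_compose) (intro comp_intro)
  ultimately show ?thesis
    unfolding hyp_value_def seq_decode_inverse by (intro partial_computable_bind)
qed

section \<open>The conjecture of the partially set-driven learner\<close>

abbreviation ext_value :: "(nat \<Rightarrow> nat \<Rightarrow> nat) \<Rightarrow> nat \<Rightarrow> nat \<Rightarrow> nat \<Rightarrow> nat \<Rightarrow> nat" where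
  "ext_value V s \<tau> x k \<equiv> V (prod_encode (seq_encode (seq_decode s @ seq_decode \<tau>), x)) k"

text \<open>
  The witness \<open>w\<close> packs two extensions of \<open>s\<close>, a point at which their hypotheses disagree and
  a stage of the approximation \<open>V\<close> of \<^const>\<open>hyp_value\<close>.
\<close>

definition refuted :: "(nat \<Rightarrow> nat \<Rightarrow> nat) \<Rightarrow> nat \<Rightarrow> nat \<Rightarrow> nat \<Rightarrow> bool" where
  "refuted V D t s \<longleftrightarrow> (\<exists>w<t.
     content_list (seq_decode (lft w)) \<subseteq> set_decode D \<and>
     content_list (seq_decode (lft (rgt w))) \<subseteq> set_decode D \<and>
     ext_value V s (lft w) (lft (rgt (rgt w))) (rgt (rgt (rgt w))) \<noteq> 0 \<and>
     ext_value V s (lft (rgt w)) (lft (rgt (rgt w))) (rgt (rgt (rgt w))) \<noteq> 0 \<and>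
     ext_value V s (lft w) (lft (rgt (rgt w))) (rgt (rgt (rgt w))) \<noteq>
     ext_value V s (lft (rgt w)) (lft (rgt (rgt w))) (rgt (rgt (rgt w))))"

text \<open>The disjunct \<open>t \<le> s\<close> only makes the search for the candidate total.\<close>

definition candidate :: "(nat \<Rightarrow> nat \<Rightarrow> nat) \<Rightarrow> nat \<Rightarrow> nat \<Rightarrow> nat" where
  "candidate V D t =
     (LEAST s. t \<le> s \<or> content_list (seq_decode s) \<subseteq> set_decode D \<and> \<not> refuted V D t s)"

text \<open>\<open>k\<close> packs an extension and a stage, so that one search dovetails all
  extensions over \<open>D\<close> and all stages.\<close>

definition converges :: "(nat \<Rightarrow> nat \<Rightarrow> nat) \<Rightarrow> nat \<Rightarrow> nat \<Rightarrow> nat \<Rightarrow> nat \<Rightarrow> bool" where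
  "converges V D s x k \<longleftrightarrow> content_list (seq_decode (lft k)) \<subseteq> set_decode D \<and>
     ext_value V s (lft k) x (rgt k) \<noteq> 0"

text \<open>\<open>p\<close> packs content and length exactly as the input of a \<open>Psd\<close>
  learner does, so a function compiling \<open>psd_value V p\<close> into an index is itself the
  learner.\<close>

definition psd_value :: "(nat \<Rightarrow> nat \<Rightarrow> nat) \<Rightarrow> nat \<Rightarrow> nat \<Rightarrow> nat option" where
  "psd_value V p x = (let D = lft p; s = candidate V D (rgt p) in
     if \<exists>k. converges V D s x k
     then let k = LEAST k. converges V D s x k in
       Some (ext_value V s (lft k) x (rgt k) - 1)
     else None)"

lemma partial_computable_psd_value:
  assumes "computable (\<lambda>p. V (lft p) (rgt p))"
  shows "partial_computable (\<lambda>n. psd_value V (lft n) (rgt n))"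
proof -
  have V: "computable (\<lambda>n. V (a n) (b n))" if "computable a" "computable b" for a b
    using computable_compose[OF assms, of "\<lambda>n. prod_encode (a n, b n)"] that by (simp add: comp_intro)
  have "decidable (\<lambda>q. refuted V (lft (lft q)) (rgt (lft q)) (rgt q))"
    unfolding refuted_def by (intro comp_intro V)
  then have "computable (\<lambda>p. candidate V (lft p) (rgt p))"
    unfolding candidate_def by (intro comp_intro) auto
  from computable_compose[OF this]
  have c: "computable (\<lambda>n. candidate V (lft (a n)) (rgt (a n)))" if "computable a" for a
    using that by simp
  have "decidable (\<lambda>q. converges V (lft (lft (lft q))) (candidate V (lft (lft (lft q))) (rgt (lft (lft q))))
    (rgt (lft q)) (rgt q))"
    unfolding converges_def by (intro comp_intro V c)
  note L = partial_computable_Least[OF this]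
  have "partial_computable (\<lambda>q. Some (ext_value V
    (candidate V (lft (lft (lft q))) (rgt (lft (lft q)))) (lft (rgt q)) (rgt (lft q)) (rgt (rgt q)) - 1))"
    by (intro partial_computable_Some comp_intro V c)
  from partial_computable_bind[OF L this] show ?thesis
    by (rule partial_computable_cong) (simp add: psd_value_def Let_def)
qed

text \<open>Let \<open>s0\<close> code a locking sequence. For large \<open>n\<close> the candidate
  is at most \<open>s0\<close>, and each of the finitely many codes of sequences over
  \<open>L\<close> up to \<open>s0\<close> is either refuted or safe, with a correct extension
  inside \<open>D n\<close>. The candidate is not refuted, hence safe.\<close>

lemma psd_value_eventually_correct:
  assumes V: "approximates V (\<lambda>p. hyp_value \<phi> h (seq_decode (lft p)) (rgt p))"
    and h: "Txt_Bc_C_learns \<phi> G h L" and T: "content T = L"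
  shows "\<forall>\<^sub>F n in sequentially. \<forall>x.
    psd_value V (prod_encode (set_encode (content_list (initial_segment T n)), n)) x =
      Some (if x \<in> L then 1 else 0)"
proof -
  define \<chi> where "\<chi> x = (if x \<in> L then 1 else 0 :: nat)" for x
  define good where "good \<sigma> \<longleftrightarrow> (\<forall>x. hyp_value \<phi> h \<sigma> x = Some (\<chi> x))" for \<sigma>
  define D where "D n = set_encode (content_list (initial_segment T n))" for n
  have D: "set_decode (D n) = content_list (initial_segment T n)" for n
    by (simp add: D_def)
  have DL: "set_decode (D n) \<subseteq> L" for n
    using content_initial_segment[of T] T by (simp add: D)
  have evD: "\<forall>\<^sub>F n in sequentially. content_list \<tau> \<subseteq> set_decode (D n)" if "content_list \<tau> \<subseteq> L" for \<tau>
    using that T by (simp add: D eventually_subset_content_initial_segment)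

  \<comment> \<open>Here \<open>T\<close> shadows the fixed text and ranges over all texts for
    \<open>L\<close>, as the locking argument requires.\<close>
  have "\<forall>\<^sub>F n in sequentially. good (initial_segment T n)" if T: "content T = L" for T
  proof -
    have "Bc_C \<phi> (G h T) T"
      using h T by (simp add: Txt_Bc_C_learns_def)
    then obtain n0 where n0: "\<forall>n\<ge>n0. \<exists>e. h (seq_encode (initial_segment T n)) = Some e \<and>
        C_index \<phi> e \<and> C_set \<phi> e = L"
      unfolding Bc_C_def G_def T by blast
    have "good (initial_segment T n)" if "n0 \<le> n" for n
    proof -
      from n0 that obtain e where e: "h (seq_encode (initial_segment T n)) = Some e"
        "C_index \<phi> e" "C_set \<phi> e = L" by blast
      have "\<phi> e x = Some (\<chi> x)" for x
        using e(2)[unfolded C_index_def, rule_format, of x] e(3) by (auto simp: C_set_def \<chi>_def)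
      with e(1) show ?thesis by (simp add: good_def hyp_value_def)
    qed
    then show ?thesis by (auto simp: eventually_sequentially)
  qed
  note lock = exists_locking_extension[of L good, OF this]

  \<comment> \<open>Weaker than locking: on extensions over \<open>L\<close> the learner or its
    hypotheses may diverge, but no wrong value appears.\<close>
  define R where "R s \<longleftrightarrow> (\<forall>\<tau> x v. content_list \<tau> \<subseteq> L \<longrightarrow>
    hyp_value \<phi> h (seq_decode s @ \<tau>) x = Some v \<longrightarrow> v = \<chi> x)" for s
  have not_refuted: "\<not> refuted V (D n) t s" if "R s" for n t s
  proof
    assume "refuted V (D n) t s"
    moreover have "ext_value V s \<tau> x k = Suc (\<chi> x)"
      if "content_list (seq_decode \<tau>) \<subseteq> set_decode (D n)" "ext_value V s \<tau> x k \<noteq> 0" for \<tau> x k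
    proof -
      from that(2) obtain v where v: "ext_value V s \<tau> x k = Suc v"
        using not0_implies_Suc by blast
      then have "hyp_value \<phi> h (seq_decode s @ seq_decode \<tau>) x = Some v"
        using approximatesD(3)[OF V v] by simp
      with v \<open>R s\<close> that(1) DL[of n] show ?thesis
        unfolding R_def by auto
    qed
    ultimately show False unfolding refuted_def by metis
  qed

  \<comment> \<open>A correct extension exists in any case. If \<open>R s\<close> fails, it
    disagrees with a wrong value at the same point; this pair refutes \<open>s\<close> once
    \<open>D n\<close> contains both extensions and \<open>n\<close> exceeds the witness.\<close>
  have ev: "\<forall>\<^sub>F n in sequentially. refuted V (D n) n s \<or>
    R s \<and> (\<exists>\<tau>. content_list \<tau> \<subseteq> set_decode (D n) \<and> good (seq_decode s @ \<tau>))"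
    if s: "content_list (seq_decode s) \<subseteq> L" for s
  proof -
    from lock[OF _ s] obtain \<tau> where \<tau>: "content_list \<tau> \<subseteq> L" "good (seq_decode s @ \<tau>)"
      by (metis append.right_neutral content_list_def empty_iff empty_set empty_subsetI mem_Collect_eq subsetI)
    show ?thesis
    proof (cases "R s")
      case True
      show ?thesis using evD[OF \<tau>(1)] by eventually_elim (use True \<tau>(2) in blast)
    next
      case False
      then obtain \<tau>' x v where \<tau>': "content_list \<tau>' \<subseteq> L"
        "hyp_value \<phi> h (seq_decode s @ \<tau>') x = Some v" "v \<noteq> \<chi> x"
        unfolding R_def by blast
      obtain k where k: "\<forall>t\<ge>k. V (prod_encode (seq_encode (seq_decode s @ \<tau>), x)) t = Suc (\<chi> x)"
        using approximatesD(2)[OF V, of "prod_encode (seq_encode (seq_decode s @ \<tau>), x)" "\<chi> x"] \<tau>(2)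
        by (auto simp: good_def)
      obtain k' where k': "\<forall>t\<ge>k'. V (prod_encode (seq_encode (seq_decode s @ \<tau>'), x)) t = Suc v"
        using approximatesD(2)[OF V, of "prod_encode (seq_encode (seq_decode s @ \<tau>'), x)" v] \<tau>'(2)
        by auto
      \<comment> \<open>At the common stage \<open>max k k'\<close> both outputs are
        visible.\<close>
      define w where "w = prod_encode (seq_encode \<tau>, prod_encode (seq_encode \<tau>', prod_encode (x, max k k')))"
      show ?thesis
        using evD[OF \<tau>(1)] evD[OF \<tau>'(1)] eventually_gt_at_top[of w]
      proof eventually_elim
        case (elim n)
        then have "refuted V (D n) n s"
          unfolding refuted_def using k k' \<tau>'(3)
          by (intro exI[of _ w]) (simp add: w_def)
        then show ?case by simp
      qed
    qed
  qed

  obtain \<sigma> where \<sigma>: "content_list \<sigma> \<subseteq> L" "\<And>\<rho>. content_list \<rho> \<subseteq> L \<Longrightarrow> good (\<sigma> @ \<rho>)"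
    using lock[of "[]"] by (auto simp: content_list_def)
  define s0 where "s0 = seq_encode \<sigma>"
  have R0: "R s0"
    using \<sigma>(2) unfolding R_def good_def s0_def by simp
  have "\<forall>\<^sub>F n in sequentially. \<forall>s\<in>{..s0}. content_list (seq_decode s) \<subseteq> L \<longrightarrow>
    refuted V (D n) n s \<or> R s \<and> (\<exists>\<tau>. content_list \<tau> \<subseteq> set_decode (D n) \<and> good (seq_decode s @ \<tau>))"
    using ev by (intro eventually_ball_finite) auto
  then show ?thesis
    using evD[OF \<sigma>(1)] eventually_gt_at_top[of s0]
  proof eventually_elim
    case (elim n)
    define s where "s = candidate V (D n) n"
    have s0: "content_list (seq_decode s0) \<subseteq> set_decode (D n) \<and> \<not> refuted V (D n) n s0"
      using elim(2) not_refuted[OF R0] by (simp add: s0_def)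
    then have "s \<le> s0"
      unfolding s_def candidate_def by (intro Least_le) simp
    \<comment> \<open>\<open>n\<close> itself satisfies the search condition;
      \<open>s \<le> s0 < n\<close> then rules out the first disjunct.\<close>
    have "n \<le> s \<or> content_list (seq_decode s) \<subseteq> set_decode (D n) \<and> \<not> refuted V (D n) n s"
      unfolding s_def candidate_def by (rule LeastI[of _ n]) simp
    with \<open>s \<le> s0\<close> elim(3) have "content_list (seq_decode s) \<subseteq> set_decode (D n)" "\<not> refuted V (D n) n s"
      by simp_all
    with elim(1) \<open>s \<le> s0\<close> DL[of n] obtain \<tau> where R: "R s"
      and \<tau>: "content_list \<tau> \<subseteq> set_decode (D n)" "good (seq_decode s @ \<tau>)"
      by (metis atMost_iff subset_trans)
    show ?case
    proof
      fix x
      obtain k where "V (prod_encode (seq_encode (seq_decode s @ \<tau>), x)) k = Suc (\<chi> x)"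
        using approximatesD(2)[OF V, of "prod_encode (seq_encode (seq_decode s @ \<tau>), x)" "\<chi> x"] \<tau>(2)
        by (auto simp: good_def)
      with \<tau>(1) have ex: "converges V (D n) s x (prod_encode (seq_encode \<tau>, k))"
        by (simp add: converges_def)
      \<comment> \<open>The good extension \<open>\<tau>\<close> makes the search succeed, but it
        may stop at another extension whose hypothesis is partial; \<open>R s\<close> still makes
        the value found correct.\<close>
      define k where "k = (LEAST k. converges V (D n) s x k)"
      have k: "converges V (D n) s x k"
        unfolding k_def using ex by (rule LeastI)
      then obtain v where v: "ext_value V s (lft k) x (rgt k) = Suc v"
        unfolding converges_def using not0_implies_Suc by blast
      have "hyp_value \<phi> h (seq_decode s @ seq_decode (lft k)) x = Some v"
        using approximatesD(3)[OF V v] by simp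
      moreover have "content_list (seq_decode (lft k)) \<subseteq> L"
        using k DL[of n] by (auto simp: converges_def)
      ultimately have "v = \<chi> x"
        using R by (auto simp: R_def)
      with ex v show "psd_value V (prod_encode (set_encode (content_list (initial_segment T n)), n)) x =
        Some (if x \<in> L then 1 else 0)"
        unfolding psd_value_def D_def[symmetric]
        by (auto simp: Let_def s_def[symmetric] k_def[symmetric] \<chi>_def)
    qed
  qed
qed

text \<open>\<open>h'\<close> is built from \<open>h\<close> alone and so serves all languages
  learned by \<open>h\<close> at once. It is the total function \<open>c\<close> that acceptability
  supplies for the sequence \<open>psd_value V\<close>.\<close>

lemma psd_learner_exists:
  assumes \<phi>: "acceptable_numbering \<phi>" and h: "partial_computable h"
  shows "\<exists>h'. partial_computable h' \<and>
    (\<forall>L. Txt_Bc_C_learns \<phi> G h L \<longrightarrow> Txt_Bc_C_learns \<phi> Psd h' L)"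
proof -
  obtain V where V: "approximates V (\<lambda>p. hyp_value \<phi> h (seq_decode (lft p)) (rgt p))"
    using partial_computable_approximates[OF partial_computable_hyp_value[OF assms]] by blast
  have "partial_computable (\<lambda>n. case prod_decode n of (e, x) \<Rightarrow> psd_value V e x)"
    using partial_computable_psd_value V by (simp add: approximates_def case_prod_beta)
  with \<phi> obtain c where c: "computable c" "\<And>e. \<phi> (c e) = psd_value V e"
    by (auto simp: acceptable_numbering_def)
  have "Txt_Bc_C_learns \<phi> Psd (\<lambda>n. Some (c n)) L" if h: "Txt_Bc_C_learns \<phi> G h L" for L
    unfolding Txt_Bc_C_learns_def
  proof (intro allI impI)
    fix T
    assume T: "content T = L"
    let ?p = "\<lambda>n. prod_encode (set_encode (content_list (initial_segment T n)), n)"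
    obtain n0 where n0: "\<forall>n\<ge>n0. \<forall>x. \<phi> (c (?p n)) x = Some (if x \<in> L then 1 else 0)"
      using psd_value_eventually_correct[OF V h T] unfolding eventually_sequentially c(2) ..
    have "C_index \<phi> (c (?p n)) \<and> C_set \<phi> (c (?p n)) = L" if "n0 \<le> n" for n
      using n0 that by (simp add: C_index_def C_set_def)
    then show "Bc_C \<phi> (Psd (\<lambda>n. Some (c n)) T) T"
      by (auto simp: Bc_C_def Psd_def T)
  qed
  moreover have "partial_computable (\<lambda>n. Some (c n))"
    using c(1) by (rule partial_computable_Some)
  ultimately show ?thesis by blast
qed

text \<open>Content and length are computable from the code of the segment, so the very same
  hypotheses are produced on every text.\<close>

lemma G_simulates_Psd:
  assumes "partial_computable h"
  shows "\<exists>h'. partial_computable h' \<and> G h' = Psd h"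
proof (intro exI conjI)
  let ?h' = "\<lambda>n. h (prod_encode (set_encode (content_list (seq_decode n)), length (seq_decode n)))"
  show "partial_computable ?h'"
    using assms by (rule partial_computable_compose) (intro comp_intro)
  show "G ?h' = Psd h"
    by (simp add: fun_eq_iff G_def Psd_def)
qed

theorem theorem17:
  fixes \<phi> :: "nat \<Rightarrow> nat \<Rightarrow> nat option"
  assumes "acceptable_numbering \<phi>"
  shows "Txt_Bc_C_REC \<phi> Psd = Txt_Bc_C_REC \<phi> G"
proof -
  have "(\<exists>h. partial_computable h \<and> (\<forall>L\<in>\<L>. Txt_Bc_C_learns \<phi> Psd h L)) \<longleftrightarrow>
    (\<exists>h. partial_computable h \<and> (\<forall>L\<in>\<L>. Txt_Bc_C_learns \<phi> G h L))" for \<L>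
    using G_simulates_Psd psd_learner_exists[OF assms]
    unfolding Txt_Bc_C_learns_def by metis
  then show ?thesis by (simp add: Txt_Bc_C_REC_def)
qed

end
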